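(* Let $q$ be an odd prime power with $q\equiv 0,\pm1\pmod 5$, and let $b$ satisfy $b^2+b=1$ (so $b\in\mathbb{F}_q$). Let $g(x)=x^q+x^{q^3}+bx^{q^5}\in\mathbb{F}_{q^6}[x]$. Then $U_g=\{(x,g(x)) : x\in\mathbb{F}_{q^6}\}$ is a maximum scattered $\mathbb{F}_q$-subspace of $\mathbb{F}_{q^6}^2$.
   Context: An $\mathbb{F}_q$-subspace $U$ of $\mathbb{F}_{q^n}^2$ of $\mathbb{F}_q$-dimension $n$ is maximum scattered if the linear set $L_U=\{\langle u\rangle_{\mathbb{F}_{q^n}} : u\in U\setminus\{0\}\}\subseteq\mathrm{PG}(1,q^n)$ has size $(q^n-1)/(q-1)$, equivalently $\dim_{\mathbb{F}_q}(U\cap\langle v\rangle_{\mathbb{F}_{q^n}})\le 1$ for every nonzero $v\in\mathbb{F}_{q^n}^2$. *)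

theory Defs
  imports
    "HOL-Library.Product_Plus"
    "HOL-Library.Cardinality"
    "HOL-Computational_Algebra.Polynomial"
    "HOL-Number_Theory.Cong"
    "HOL-Number_Theory.Prime_Powers"
begin

text \<open>
  An extension of fields \<open>k \<subseteq> l\<close> is given by two field types and a unital ring homomorphism
  \<open>h\<close> between them; \<open>k\<close> is identified with \<open>range h\<close>. Injectivity is automatic.
\<close>

locale field_embedding =
  fixes h :: "'k::field \<Rightarrow> 'l::field"
  assumes hom_add: "h (x + y) = h x + h y"
    and hom_mult: "h (x * y) = h x * h y"
    and hom_one: "h 1 = 1"

definition pair_scale :: "'l::field \<Rightarrow> 'l \<times> 'l \<Rightarrow> 'l \<times> 'l" where
  "pair_scale c v = (c * fst v, c * snd v)"

definition restr_scale :: "('k::field \<Rightarrow> 'l::field) \<Rightarrow> 'k \<Rightarrow> 'l \<times> 'l \<Rightarrow> 'l \<times> 'l" where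
  "restr_scale h c = pair_scale (h c)"

lemma vector_space_pair_scale: "vector_space (pair_scale :: 'l::field \<Rightarrow> _)"
  by unfold_locales (auto simp: pair_scale_def prod_eq_iff algebra_simps)

lemma (in field_embedding) vector_space_restr_scale: "vector_space (restr_scale h)"
  by unfold_locales
    (auto simp: restr_scale_def pair_scale_def prod_eq_iff hom_add hom_mult hom_one algebra_simps)

text \<open>
  The points of \<open>PG(1, l)\<close> are the one-dimensional \<open>l\<close>-subspaces of \<open>l \<times> l\<close>.
\<close>

definition linear_set :: "('l::field \<times> 'l) set \<Rightarrow> ('l \<times> 'l) set set" where
  "linear_set U = (\<lambda>u. module.span pair_scale {u}) ` (U - {0})"

text \<open>
  Here \<open>n\<close> stands for the degree of the extension, that is, \<open>CARD('l) = CARD('k) ^ n\<close>.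
  The division is exact.
\<close>

definition maximum_scattered ::
    "('k::{field,finite} \<Rightarrow> 'l::{field,finite}) \<Rightarrow> nat \<Rightarrow> ('l \<times> 'l) set \<Rightarrow> bool" where
  "maximum_scattered h n U \<longleftrightarrow>
     module.subspace (restr_scale h) U \<and>
     vector_space.dim (restr_scale h) U = n \<and>
     card (linear_set U) = (CARD('k) ^ n - 1) div (CARD('k) - 1)"

end

theory Submission
  imports Defs
begin

text \<open>
  Write \<open>z\<^sub>i = z ^ (q ^ i)\<close>, indices modulo 6. The graph is scattered iff \<open>g x = m x\<close>, \<open>g y = m y\<close> and
  \<open>x \<noteq> 0\<close> force \<open>y / x\<close> into the small field. The six conjugates of \<open>g x = m x\<close> form a linear system in the
  \<open>x\<^sub>i\<close>; since \<open>b\<^sup>2 + b = 1\<close>, the variables with odd index can be eliminated explicitly, leaving three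
  equations in \<open>(x\<^sub>0, x\<^sub>2, x\<^sub>4)\<close>. If \<open>y / x\<close> is not in the small field, \<open>(y\<^sub>0, y\<^sub>2, y\<^sub>4)\<close> is an independent
  solution, so the coefficient matrix has rank at most one. With \<open>n\<^sub>i = m\<^sub>i m\<^sub>i\<^sub>+\<^sub>1\<close>, comparing one
  \<open>2 \<times> 2\<close> minor with its third conjugate gives \<open>n\<^sub>0 = n\<^sub>3\<close> in odd characteristic, and the
  remaining minors give \<open>n\<^sub>0 + n\<^sub>1 + n\<^sub>2 = b - 1\<close> and
  \<open>n\<^sub>0 n\<^sub>1 + n\<^sub>1 n\<^sub>2 + n\<^sub>2 n\<^sub>0 = - (b + 2) n\<^sub>0 n\<^sub>1 n\<^sub>2\<close>. As \<open>(b - 1) (b + 2) = -1\<close>, it follows that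
  \<open>(n\<^sub>0 + n\<^sub>1) (n\<^sub>1 + n\<^sub>2) (n\<^sub>2 + n\<^sub>0) = 0\<close>; conjugating the vanishing factor yields \<open>2 n\<^sub>0 = 0\<close>, so
  \<open>m = 0\<close>, which is impossible because the system for \<open>m = 0\<close> is regular.

  That \<open>b\<close> lies in the small field follows from \<open>b = z + z\<^sup>-\<^sup>1\<close> for a primitive fifth root of unity
  \<open>z\<close>, or \<open>b = 2\<close> in characteristic 5.
\<close>

section \<open>Linear algebra: elimination and vanishing minors\<close>

text \<open>Fourth linear equation, minus \<open>m1\<close> times the first, plus
  \<open>(b + 1) * m1\<close> times the second, minus \<open>m1\<close> times the third:
  \<open>x3\<close> and \<open>x5\<close> cancel identically, and \<open>x1\<close> is left with
  coefficient \<open>m1 * (b\<^sup>2 + b - 1)\<close>.\<close>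

lemma eliminated_row:
  fixes b :: "'a::field"
  assumes b: "b\<^sup>2 + b = 1"
    and "x1 + x3 + b * x5 = m0 * x0" and "x3 + x5 + b * x1 = m2 * x2"
    and "x5 + x1 + b * x3 = m4 * x4" and "x2 + x4 + b * x0 = m1 * x1"
  shows "(b - m0 * m1) * x0 + (1 + (b + 1) * (m1 * m2)) * x2 + (1 - m1 * m4) * x4 = 0"
proof -
  have "(b - m0 * m1) * x0 + (1 + (b + 1) * (m1 * m2)) * x2 + (1 - m1 * m4) * x4
      = (x2 + x4 + b * x0) - m1 * (m0 * x0) + (b + 1) * m1 * (m2 * x2) - m1 * (m4 * x4)"
    by (simp add: algebra_simps)
  also have "\<dots> = m1 * x1 - m1 * (x1 + x3 + b * x5) + (b + 1) * m1 * (x3 + x5 + b * x1)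
      - m1 * (x5 + x1 + b * x3)"
    using assms(2-) by simp
  also have "\<dots> = m1 * x1 * (b\<^sup>2 + b - 1)"
    by (simp add: algebra_simps power2_eq_square)
  finally show ?thesis using b by simp
qed

text \<open>Vectors orthogonal to both \<open>u\<close> and \<open>v\<close> are multiples of their
  cross product when it is nonzero; the last assumption says that its middle coordinate does not
  vanish.\<close>

lemma orthogonal_minor_eq_0:
  fixes u0 :: "'a::field"
  assumes "a0 * u0 + a1 * u1 + a2 * u2 = 0" "a0 * v0 + a1 * v1 + a2 * v2 = 0"
    and "c0 * u0 + c1 * u1 + c2 * u2 = 0" "c0 * v0 + c1 * v1 + c2 * v2 = 0"
    and "u2 * v0 \<noteq> u0 * v2"
  shows "a0 * c1 = a1 * c0"
proof -
  have *: "p0 * (u2 * v0 - u0 * v2) = p1 * (u1 * v2 - u2 * v1)"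
    if p: "p0 * u0 + p1 * u1 + p2 * u2 = 0" "p0 * v0 + p1 * v1 + p2 * v2 = 0" for p0 p1 p2
  proof -
    have "p0 * (u2 * v0 - u0 * v2) - p1 * (u1 * v2 - u2 * v1)
        = u2 * (p0 * v0 + p1 * v1 + p2 * v2) - v2 * (p0 * u0 + p1 * u1 + p2 * u2)"
      by algebra
    thus ?thesis unfolding p by simp
  qed
  have "(a0 * c1 - a1 * c0) * (u2 * v0 - u0 * v2)
      = c1 * (a0 * (u2 * v0 - u0 * v2)) - a1 * (c0 * (u2 * v0 - u0 * v2))"
    by (simp add: algebra_simps)
  also have "\<dots> = 0"
    unfolding *[OF assms(1,2)] *[OF assms(3,4)] by (simp add: mult_ac)
  finally have "(a0 * c1 - a1 * c0) * (u2 * v0 - u0 * v2) = 0" .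
  thus ?thesis using assms(5) by simp
qed

section \<open>Field automorphisms whose sixth power is the identity\<close>

text \<open>Abstracts the map \<open>x ^ q\<close> of the large field, so that conjugating an
  equation amounts to rewriting with the homomorphism laws, with no large exponents in
  sight.\<close>

locale order6_automorphism =
  fixes \<phi> :: "'a::field \<Rightarrow> 'a"
  assumes add: "\<phi> (x + y) = \<phi> x + \<phi> y"
    and mult: "\<phi> (x * y) = \<phi> x * \<phi> y"
    and one: "\<phi> 1 = 1"
    and order6: "\<phi> (\<phi> (\<phi> (\<phi> (\<phi> (\<phi> x))))) = x"
begin

lemma zero: "\<phi> 0 = 0"
  using add[of 0 0] by (metis add.right_neutral add_left_cancel)

lemma diff: "\<phi> (x - y) = \<phi> x - \<phi> y"
  using add[of "x - y" y] by (simp add: algebra_simps)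

lemmas hom = add mult one zero diff order6

lemma eq_iff: "\<phi> x = \<phi> y \<longleftrightarrow> x = y"
  by (metis order6)

lemma eq_0_iff: "\<phi> x = 0 \<longleftrightarrow> x = 0"
  by (metis zero order6)

text \<open>\<open>A\<close>, \<open>B\<close> and \<open>C\<close> are the three minors of the
  eliminated row and its second conjugate, for columns (0,1), (1,2) and (0,2).\<close>

lemma minors_contradiction:
  fixes b m :: 'a
  assumes two_neq: "(2::'a) \<noteq> 0" and b: "b\<^sup>2 + b = 1" and fb: "\<phi> b = b" and m: "m \<noteq> 0"
    and m1: "m1 = \<phi> m" and m2: "m2 = \<phi> m1" and m3: "m3 = \<phi> m2" and m4: "m4 = \<phi> m3"
    and m5: "m5 = \<phi> m4"
    and A: "(b - m * m1) * (b - m2 * m3) = (1 + (b + 1) * (m1 * m2)) * (1 - m3 * m)"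
    and B: "(1 + (b + 1) * (m1 * m2)) * (1 + (b + 1) * (m3 * m4)) = (1 - m1 * m4) * (b - m2 * m3)"
    and C: "(b - m * m1) * (1 + (b + 1) * (m3 * m4)) = (1 - m1 * m4) * (1 - m3 * m)"
  shows False
proof -
  have m0: "\<phi> m5 = m" by (simp add: m1 m2 m3 m4 m5 order6)
  note fm = m0 m1[symmetric] m2[symmetric] m3[symmetric] m4[symmetric] m5[symmetric]
  \<comment> \<open>The third conjugation swaps the two factors on the right of \<open>C\<close>, so
    both left sides agree; their difference is linear in \<open>m * m1 - m3 * m4\<close>.\<close>
  have C': "(b - m3 * m4) * (1 + (b + 1) * (m * m1)) = (1 - m4 * m1) * (1 - m * m3)"
    using arg_cong[OF C, of "\<lambda>x. \<phi> (\<phi> (\<phi> x))"] by (simp add: hom fm fb)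
  have "(1 + b * (b + 1)) * (m * m1 - m3 * m4)
      = (b - m3 * m4) * (1 + (b + 1) * (m * m1)) - (b - m * m1) * (1 + (b + 1) * (m3 * m4))"
    by algebra
  also have "\<dots> = 0" unfolding C C' by (simp add: mult.commute)
  finally have "(1 + b * (b + 1)) * (m * m1 - m3 * m4) = 0" .
  moreover have "b * (b + 1) = 1" using b by algebra
  ultimately have "2 * (m * m1 - m3 * m4) = 0" by simp
  hence n03: "m3 * m4 = m * m1" using two_neq by simp
  \<comment> \<open>Conjugated once, \<open>A\<close> involves only the quantities
    \<open>n0\<close>, \<open>n1\<close>, \<open>n2\<close>, \<open>e\<close> that also occur in
    \<open>B\<close>.\<close>
  have A': "(b - m1 * m2) * (b - m3 * m4) = (1 + (b + 1) * (m2 * m3)) * (1 - m4 * m1)"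
    using arg_cong[OF A, of \<phi>] by (simp add: hom fm fb)
  define n0 n1 n2 e where n: "n0 = m * m1" "n1 = m1 * m2" "n2 = m2 * m3" "e = m1 * m4"
  have "e * n2 = n1 * (m3 * m4)" by (simp add: n mult_ac)
  hence e: "e * n2 = n0 * n1" unfolding n03 by (simp add: n mult_ac)
  have A2: "(b - n1) * (b - n0) = (1 + (b + 1) * n2) * (1 - e)"
    using A' n03 by (simp add: n mult.commute)
  have B2: "(1 + (b + 1) * n1) * (1 + (b + 1) * n0) = (1 - e) * (b - n2)"
    using B n03 by (simp add: n)
  have "(b + 2) * (n0 * n1) + e - (b + b * (n0 + n1) + (b + 1) * n2)
      = (b - n1) * (b - n0) - (1 + (b + 1) * n2) * (1 - e)
        + (b + 1) * (n0 * n1 - e * n2) - (b\<^sup>2 + b - 1)"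
    by algebra
  also have "\<dots> = 0" unfolding A2 e b by simp
  finally have A3: "(b + 2) * (n0 * n1) + e = b + b * (n0 + n1) + (b + 1) * n2" by simp
  \<comment> \<open>The factor \<open>b + 1\<close> is the inverse of \<open>b\<close>; it gives
    \<open>B2\<close> the same leading part \<open>(b + 2) * (n0 * n1) + e\<close> as
    \<open>A3\<close>, ready to be eliminated.\<close>
  have "(b + 2) * (n0 * n1) + e + (b + (b + 2) * (n0 + n1) + (b + 1) * n2)
      = (b + 1) * ((1 + (b + 1) * n1) * (1 + (b + 1) * n0) - (1 - e) * (b - n2)
          + (e * n2 - n0 * n1))
        - (b\<^sup>2 + b - 1) * (n0 + n1 + (b + 2) * (n0 * n1) + e - 1)"
    by algebra
  also have "\<dots> = 0" unfolding B2 e b by simp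
  finally have B3: "(b + 2) * (n0 * n1) + e + (b + (b + 2) * (n0 + n1) + (b + 1) * n2) = 0" .
  have "2 * (b + (b + 1) * (n0 + n1 + n2)) = 0"
    using B3 unfolding A3 by (simp add: algebra_simps)
  hence *: "b + (b + 1) * (n0 + n1 + n2) = 0" using two_neq by (metis mult_eq_0_iff)
  have "n0 + n1 + n2 - (b - 1)
      = b * (b + (b + 1) * (n0 + n1 + n2)) - (b\<^sup>2 + b - 1) * (n0 + n1 + n2 + 1)"
    by algebra
  also have "\<dots> = 0" unfolding * b by simp
  finally have S: "n0 + n1 + n2 = b - 1" by simp
  have "b + b * (n0 + n1) + (b + 1) * n2
      = b * (n0 + n1 + n2 - (b - 1)) + (n0 + n1 + n2 - (b - 1)) + (b\<^sup>2 + b - 1) - (n0 + n1)"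
    by algebra
  also have "\<dots> = - (n0 + n1)" unfolding S b by simp
  finally have A4: "(b + 2) * (n0 * n1) + e = - (n0 + n1)" unfolding A3 .
  have "n0 * n1 + n1 * n2 + n2 * n0 + (b + 2) * (n0 * n1 * n2)
      = n2 * ((b + 2) * (n0 * n1) + e) + (n0 * n1 - e * n2) + n2 * (n0 + n1)"
    by algebra
  also have "\<dots> = 0" unfolding A4 e by (simp add: algebra_simps)
  finally have T: "n0 * n1 + n1 * n2 + n2 * n0 + (b + 2) * (n0 * n1 * n2) = 0" .
  \<comment> \<open>In elementary symmetric functions the product is \<open>s1 * s2 - s3\<close>;
    \<open>S\<close> and \<open>T\<close> supply \<open>s1\<close> and \<open>s2\<close>.\<close>
  have "(n0 + n1) * (n1 + n2) * (n2 + n0)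
      = (n0 + n1 + n2 - (b - 1)) * (n0 * n1 + n1 * n2 + n2 * n0)
        + (b - 1) * (n0 * n1 + n1 * n2 + n2 * n0 + (b + 2) * (n0 * n1 * n2))
        - (b\<^sup>2 + b - 1) * (n0 * n1 * n2)"
    by algebra
  also have "\<dots> = 0" unfolding S T b by simp
  finally have "(n0 + n1) * (n1 + n2) * (n2 + n0) = 0" .
  moreover have f: "\<phi> n0 = n1" "\<phi> n1 = n2" "\<phi> n2 = n0"
    using n03 by (simp_all add: n hom fm)
  ultimately have "n0 + n1 = 0 \<or> n1 + n2 = 0 \<or> n2 + n0 = 0" by simp
  moreover have "n1 + n2 = 0 \<longleftrightarrow> n0 + n1 = 0" "n2 + n0 = 0 \<longleftrightarrow> n1 + n2 = 0"
    using eq_0_iff[of "n0 + n1"] eq_0_iff[of "n1 + n2"] by (simp_all add: add f)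
  ultimately have "n0 + n1 = 0" "n1 + n2 = 0" "n2 + n0 = 0" by auto
  hence "2 * n0 = 0" by algebra
  hence "n0 = 0" using two_neq by simp
  thus False using m by (simp add: n m1 eq_0_iff)
qed

text \<open>The conclusion is the division-free form of
  \<open>\<phi> (y / x) = y / x\<close>.\<close>

lemma fixed_ratio_if_common_multiplier:
  fixes b m x y :: 'a
  assumes two_neq: "(2::'a) \<noteq> 0" and b: "b\<^sup>2 + b = 1" and fb: "\<phi> b = b" and x: "x \<noteq> 0"
    and kx: "\<phi> x + \<phi> (\<phi> (\<phi> x)) + b * \<phi> (\<phi> (\<phi> (\<phi> (\<phi> x)))) = m * x"
    and ky: "\<phi> y + \<phi> (\<phi> (\<phi> y)) + b * \<phi> (\<phi> (\<phi> (\<phi> (\<phi> y)))) = m * y"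
  shows "x * \<phi> y = \<phi> x * y"
proof (rule ccontr)
  assume neq: "x * \<phi> y \<noteq> \<phi> x * y"
  define m1 m2 m3 m4 m5 where m: "m1 = \<phi> m" "m2 = \<phi> m1" "m3 = \<phi> m2" "m4 = \<phi> m3" "m5 = \<phi> m4"
  have row: "(b - m * m1) * z + (1 + (b + 1) * (m1 * m2)) * \<phi> (\<phi> z)
      + (1 - m1 * m4) * \<phi> (\<phi> (\<phi> (\<phi> z))) = 0"
    if "\<phi> z + \<phi> (\<phi> (\<phi> z)) + b * \<phi> (\<phi> (\<phi> (\<phi> (\<phi> z)))) = m * z" for z
  proof (rule eliminated_row[OF b that])
    show "\<phi> (\<phi> (\<phi> z)) + \<phi> (\<phi> (\<phi> (\<phi> (\<phi> z)))) + b * \<phi> z = m2 * \<phi> (\<phi> z)"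
      using arg_cong[OF that, of "\<lambda>x. \<phi> (\<phi> x)"] by (simp add: hom fb m)
    show "\<phi> (\<phi> (\<phi> (\<phi> (\<phi> z)))) + \<phi> z + b * \<phi> (\<phi> (\<phi> z)) = m4 * \<phi> (\<phi> (\<phi> (\<phi> z)))"
      using arg_cong[OF that, of "\<lambda>x. \<phi> (\<phi> (\<phi> (\<phi> x)))"] by (simp add: hom fb m)
    show "\<phi> (\<phi> z) + \<phi> (\<phi> (\<phi> (\<phi> z))) + b * z = m1 * \<phi> z"
      using arg_cong[OF that, of \<phi>] by (simp add: hom fb m)
  qed
  have row2: "(1 - m3 * m) * z + (b - m2 * m3) * \<phi> (\<phi> z)
      + (1 + (b + 1) * (m3 * m4)) * \<phi> (\<phi> (\<phi> (\<phi> z))) = 0"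
    if "\<phi> z + \<phi> (\<phi> (\<phi> z)) + b * \<phi> (\<phi> (\<phi> (\<phi> (\<phi> z)))) = m * z" for z
    using arg_cong[OF row[OF that], of "\<lambda>x. \<phi> (\<phi> x)"] by (simp add: hom fb m add_ac)
  \<comment> \<open>For \<open>m = 0\<close> the odd conjugates form a circulant system with entries
    \<open>b\<close>, 1, 1 and determinant \<open>(b - 1)\<^sup>2 * (b + 2)\<close>, which is
    nonzero because \<open>(b - 1) * (b + 2) = -1\<close>.\<close>
  have m_nz: "m \<noteq> 0"
  proof
    assume "m = 0"
    with kx have k: "\<phi> x + \<phi> (\<phi> (\<phi> x)) + b * \<phi> (\<phi> (\<phi> (\<phi> (\<phi> x)))) = 0" by simp
    have "\<phi> (\<phi> x) + \<phi> (\<phi> (\<phi> (\<phi> x))) + b * x = 0"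
      using arg_cong[OF k, of \<phi>] by (simp add: hom fb)
    moreover have "\<phi> (\<phi> (\<phi> (\<phi> x))) + x + b * \<phi> (\<phi> x) = 0"
      using arg_cong[OF k, of "\<lambda>x. \<phi> (\<phi> (\<phi> x))"] by (simp add: hom fb)
    moreover have "x + \<phi> (\<phi> x) + b * \<phi> (\<phi> (\<phi> (\<phi> x))) = 0"
      using arg_cong[OF k, of "\<lambda>x. \<phi> (\<phi> (\<phi> (\<phi> (\<phi> x))))"] by (simp add: hom fb)
    ultimately have "x = 0" using b by algebra
    with x show False by simp
  qed
  \<comment> \<open>If the square of \<open>\<phi>\<close> fixed \<open>y / x\<close>, all odd
    conjugates of \<open>y\<close> and \<open>x\<close> would have ratio
    \<open>\<phi> y / \<phi> x\<close>. By \<open>kx\<close> and \<open>ky\<close>,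
    \<open>m * y\<close> and \<open>m * x\<close> would then have that ratio too.\<close>
  have w: "x * \<phi> (\<phi> y) \<noteq> \<phi> (\<phi> x) * y"
  proof
    assume *: "x * \<phi> (\<phi> y) = \<phi> (\<phi> x) * y"
    have 1: "\<phi> x * \<phi> (\<phi> (\<phi> y)) = \<phi> (\<phi> (\<phi> x)) * \<phi> y"
      using arg_cong[OF *, of \<phi>] by (simp add: hom)
    have 2: "\<phi> x * \<phi> (\<phi> (\<phi> (\<phi> (\<phi> y)))) = \<phi> (\<phi> (\<phi> (\<phi> (\<phi> x)))) * \<phi> y"
      using arg_cong[OF *, of "\<lambda>x. \<phi> (\<phi> (\<phi> (\<phi> (\<phi> x))))"] by (simp add: hom mult.commute)
    have "m * (x * \<phi> y - \<phi> x * y) = 0"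
      using kx ky 1 2 by algebra
    with m_nz neq show False by simp
  qed
  have w2: "\<phi> (\<phi> x) * \<phi> (\<phi> (\<phi> (\<phi> y))) \<noteq> \<phi> (\<phi> (\<phi> (\<phi> x))) * \<phi> (\<phi> y)"
    using w by (simp add: eq_iff flip: mult)
  have "\<phi> (\<phi> (\<phi> (\<phi> (x * \<phi> (\<phi> y))))) \<noteq> \<phi> (\<phi> (\<phi> (\<phi> (\<phi> (\<phi> x) * y))))"
    using w by (simp add: eq_iff)
  hence w4: "\<phi> (\<phi> (\<phi> (\<phi> x))) * y \<noteq> x * \<phi> (\<phi> (\<phi> (\<phi> y)))"
    by (simp add: hom)
  note R = row[OF kx] row[OF ky] row2[OF kx] row2[OF ky]
  show False
  proof (rule minors_contradiction[OF two_neq b fb m_nz m])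
    show "(b - m * m1) * (b - m2 * m3) = (1 + (b + 1) * (m1 * m2)) * (1 - m3 * m)"
      by (rule orthogonal_minor_eq_0[OF R w4])
    \<comment> \<open>Here and for the next minor the coordinates are shifted cyclically, so that
      the required nonvanishing becomes \<open>w\<close> or its conjugate \<open>w2\<close>.\<close>
    show "(1 + (b + 1) * (m1 * m2)) * (1 + (b + 1) * (m3 * m4)) = (1 - m1 * m4) * (b - m2 * m3)"
      by (rule orthogonal_minor_eq_0[where ?u1.0 = "\<phi> (\<phi> (\<phi> (\<phi> x)))" and ?v1.0 = "\<phi> (\<phi> (\<phi> (\<phi> y)))" and
            ?a2.0 = "b - m * m1" and ?c2.0 = "1 - m3 * m", OF _ _ _ _ w]) (use R in \<open>simp_all add: add_ac\<close>)
    have "(1 - m1 * m4) * (1 - m3 * m) = (b - m * m1) * (1 + (b + 1) * (m3 * m4))"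
      by (rule orthogonal_minor_eq_0[where ?u1.0 = x and ?v1.0 = y and
            ?a2.0 = "1 + (b + 1) * (m1 * m2)" and ?c2.0 = "b - m2 * m3", OF _ _ _ _ w2]) (use R in \<open>simp_all add: add_ac\<close>)
    thus "(b - m * m1) * (1 + (b + 1) * (m3 * m4)) = (1 - m1 * m4) * (1 - m3 * m)" ..
  qed
qed

end

section \<open>Finite fields: power maps and characteristic\<close>

lemma finite_field_power_card:
  fixes x :: "'a::{field,finite}"
  shows "x ^ CARD('a) = x"
proof (cases "x = 0")
  case False
  have "(\<Prod>y\<in>UNIV-{0}. x * y) = (\<Prod>y\<in>UNIV-{0}. y)"
    by (rule prod.reindex_bij_witness[of _ "\<lambda>y. y / x" "\<lambda>y. x * y"]) (use False in auto)
  hence "x ^ (CARD('a) - 1) * \<Prod>(UNIV-{0::'a}) = \<Prod>(UNIV-{0})"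
    by (simp add: prod.distrib card_Diff_singleton)
  hence "x ^ (CARD('a) - 1) = 1" by simp
  thus ?thesis using power_minus_mult[of "CARD('a)" x] by simp
qed (simp add: zero_power)

text \<open>Translation by 1 permutes the field, so summing over all elements gives
  \<open>of_nat CARD('a) = 0\<close>.\<close>

lemma CHAR_dvd_CARD: "CHAR('a::{field,finite}) dvd CARD('a)"
proof -
  have "(\<Sum>y\<in>UNIV. y + 1) = (\<Sum>y\<in>UNIV. y :: 'a)"
    by (rule sum.reindex_bij_witness[of _ "\<lambda>y. y - 1" "\<lambda>y. y + 1"]) auto
  hence "of_nat CARD('a) = (0 :: 'a)" by (simp add: sum.distrib)
  thus ?thesis by (simp add: of_nat_eq_0_iff_char_dvd)
qed

lemma finite_field_prime_CHAR: "prime CHAR('a::{field,finite})"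
  by (rule prime_CHAR_semidom) (simp add: finite_imp_CHAR_pos)

lemma primepow_eq_CHAR_power:
  assumes "primepow q" and "CARD('a::{field,finite}) = q ^ n"
  obtains k where "q = CHAR('a) ^ k"
proof -
  obtain p k where p: "prime p" "q = p ^ k" using assms(1) by (auto simp: primepow_def)
  have "CHAR('a) dvd p ^ (k * n)"
    using CHAR_dvd_CARD[where ?'a = 'a] assms(2) p(2) by (simp add: power_mult)
  hence "CHAR('a) = p"
    using finite_field_prime_CHAR[where ?'a = 'a] p(1) by (metis prime_dvd_power primes_dvd_imp_eq)
  thus thesis using that p(2) by blast
qed

lemma finite_field_power_add:
  fixes x y :: "'a::{field,finite}"
  assumes "primepow q" and "CARD('a) = q ^ n"
  shows "(x + y) ^ q = x ^ q + y ^ q"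
  using primepow_eq_CHAR_power[OF assms] freshmans_dream'[OF finite_field_prime_CHAR] by metis

lemma finite_field_two_neq_0:
  assumes "odd CARD('a::{field,finite})"
  shows "(2::'a) \<noteq> 0"
proof
  assume "(2::'a) = 0"
  hence "CHAR('a) dvd 2" using of_nat_eq_0_iff_char_dvd[where ?'a = 'a, of 2] by simp
  hence "CHAR('a) = 2"
    by (metis CHAR_not_1 One_nat_def prime_nat_iff two_is_prime_nat)
  thus False using CHAR_dvd_CARD[where ?'a = 'a] assms by simp
qed

section \<open>Cardinality and dimension over a finite field\<close>

lemma (in vector_space) card_span_independent:
  fixes B :: "'b set"
  assumes "finite (UNIV :: 'a set)" and "finite B" and "independent B"
  shows "card (span B) = CARD('a) ^ card B"
  using assms(2,3)
proof (induction B)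
  case (insert a B)
  hence a: "a \<notin> span B" and ind: "independent B" by (auto simp: independent_insert)
  have "bij_betw (\<lambda>(k, v). k *s a + v) (UNIV \<times> span B) (span (insert a B))"
    unfolding bij_betw_def
  proof (intro conjI inj_onI equalityI subsetI)
    fix p p' assume *: "p \<in> UNIV \<times> span B" "p' \<in> UNIV \<times> span B"
      "(case p of (k, v) \<Rightarrow> k *s a + v) = (case p' of (k, v) \<Rightarrow> k *s a + v)"
    obtain k v k' v' where p: "p = (k, v)" "p' = (k', v')" by fastforce
    have eq: "(k - k') *s a = v' - v" and v: "v \<in> span B" "v' \<in> span B"
      using * p by (auto simp: scale_left_diff_distrib algebra_simps)
    have "k = k'"
    proof (rule ccontr)
      assume "k \<noteq> k'"
      hence "a = inverse (k - k') *s (v' - v)" by (simp flip: eq)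
      thus False using a v by (simp add: span_diff span_scale)
    qed
    thus "p = p'" using eq p by simp
  next
    fix w assume "w \<in> span (insert a B)"
    then obtain k where "w - k *s a \<in> span B" by (auto simp: span_insert)
    thus "w \<in> (\<lambda>(k, v). k *s a + v) ` (UNIV \<times> span B)"
      by (intro image_eqI[of _ _ "(k, w - k *s a)"]) auto
  qed (auto intro: span_add span_scale span_base span_mono[THEN subsetD, OF subset_insertI])
  thus ?case
    using insert.IH[OF ind] insert.hyps
    by (simp add: bij_betw_same_card[symmetric] card_cartesian_product)
qed simp

lemma (in vector_space) card_eq_power_dim:
  assumes "finite (UNIV :: 'a set)" and "finite V" and "subspace V"
  shows "card V = CARD('a) ^ dim V"
proof -
  obtain B where B: "B \<subseteq> V" "independent B" "V \<subseteq> span B" "card B = dim V"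
    by (rule basis_exists)
  moreover have "span B = V" using B assms(3) by (metis span_minimal subset_antisym)
  ultimately show ?thesis
    using card_span_independent[OF assms(1) _ B(2)] finite_subset[OF _ assms(2)] by auto
qed

section \<open>Field embeddings and their image\<close>

lemma (in field_embedding) hom_zero: "h 0 = 0"
  using hom_add[of 0 0] by (metis add.right_neutral add_left_cancel)

lemma (in field_embedding) hom_power: "h (x ^ n) = h x ^ n"
  by (induction n) (simp_all add: hom_one hom_mult)

lemma (in field_embedding) hom_eq_0_iff: "h x = 0 \<longleftrightarrow> x = 0"
proof
  assume "h x = 0"
  hence "h (x * inverse x) = 0" by (simp add: hom_mult)
  thus "x = 0" using hom_one by (cases "x = 0") auto
qed (simp add: hom_zero)

lemma (in field_embedding) inj_hom: "inj h"
proof (rule injI)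
  fix x y assume "h x = h y"
  moreover have "h x = h (x - y) + h y" by (simp flip: hom_add)
  ultimately show "x = y" by (simp add: hom_eq_0_iff)
qed

text \<open>With \<open>q = CARD('k)\<close>, the polynomial \<open>X^q - X\<close> has at most
  \<open>q\<close> roots, and the image of \<open>h\<close> already provides \<open>q\<close> of
  them.\<close>

lemma power_card_fixed_iff_in_range:
  fixes h :: "'k::{field,finite} \<Rightarrow> 'l::{field,finite}"
  assumes "field_embedding h"
  shows "x ^ CARD('k) = x \<longleftrightarrow> x \<in> range h"
proof -
  interpret field_embedding h by fact
  define p :: "'l poly" where "p = monom 1 CARD('k) - monom 1 1"
  have gt: "CARD('k) > 1"
    using card_mono[of UNIV "{0,1::'k}"] by simp
  have "coeff p CARD('k) = 1" using gt by (simp add: p_def)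
  hence p: "p \<noteq> 0" by auto
  have "degree p \<le> CARD('k)"
    unfolding p_def by (rule degree_diff_le) (use gt in \<open>auto simp: degree_monom_eq\<close>)
  hence "card {x. poly p x = 0} \<le> CARD('k)" using card_poly_roots_bound[OF p] by simp
  moreover have "card (range h) = CARD('k)" by (rule card_image[OF inj_hom])
  moreover have "range h \<subseteq> {x. poly p x = 0}"
    by (auto simp: p_def poly_monom finite_field_power_card simp flip: hom_power)
  ultimately have "range h = {x. poly p x = 0}"
    by (metis card_seteq finite)
  thus ?thesis by (auto simp: p_def poly_monom)
qed

section \<open>Fifth roots of unity and the element \<open>b\<close>\<close>

text \<open>The root is \<open>x ^ d\<close> with \<open>d\<close> a fifth of the group order;
  \<open>X^d - 1\<close> has too few roots for this to be 1 at every nonzero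
  \<open>x\<close>.\<close>

lemma exists_primitive_fifth_root:
  assumes "[CARD('a) = 1] (mod 5)"
  shows "\<exists>z::'a::{field,finite}. z ^ 5 = 1 \<and> z \<noteq> 1"
proof -
  define d where "d = (CARD('a) - 1) div 5"
  have gt: "CARD('a) > 1"
    using card_mono[of UNIV "{0,1::'a}"] by simp
  have "CARD('a) mod 5 = 1" using assms by (simp add: cong_def)
  hence d: "CARD('a) = Suc (d * 5)" and d0: "d > 0" using gt unfolding d_def by presburger+
  have "\<exists>x::'a. x \<noteq> 0 \<and> x ^ d \<noteq> 1"
  proof (rule ccontr)
    assume *: "\<not> ?thesis"
    define p :: "'a poly" where "p = monom 1 d - 1"
    have "coeff p d = 1" using d0 by (simp add: p_def)
    hence p: "p \<noteq> 0" by auto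
    have "CARD('a) - 1 = card (UNIV - {0::'a})" by (simp add: card_Diff_singleton)
    also have "\<dots> \<le> card {x. poly p x = 0}"
      by (rule card_mono) (use * in \<open>auto simp: p_def poly_monom\<close>)
    also have "\<dots> \<le> degree p" by (rule card_poly_roots_bound[OF p])
    also have "\<dots> \<le> d" unfolding p_def by (rule degree_diff_le) (auto simp: degree_monom_eq)
    finally show False using d d0 by simp
  qed
  then obtain x :: 'a where x: "x \<noteq> 0" "x ^ d \<noteq> 1" by blast
  have "x * (x ^ d) ^ 5 = x"
    using finite_field_power_card[of x] d by (simp add: power_mult)
  thus ?thesis using x by (intro exI[of _ "x ^ d"]) simp
qed

text \<open>Away from characteristic 5, evenness of \<open>n\<close> puts a primitive fifth root of
  unity \<open>z\<close> into the field. As \<open>q\<close> is 1 or -1 modulo 5, the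
  \<open>q\<close>-th power fixes or inverts \<open>z\<close>, and hence fixes
  \<open>z + z ^ 4\<close>.\<close>

lemma golden_root_power_eq_self:
  fixes b :: "'a::{field,finite}"
  assumes q: "primepow q" and card: "CARD('a) = q ^ n" and n: "even n"
    and mod5: "[int q = 0] (mod 5) \<or> [int q = 1] (mod 5) \<or> [int q = -1] (mod 5)"
    and b: "b\<^sup>2 + b = 1"
  shows "b ^ q = b"
proof (cases "5 dvd q")
  case True
  obtain k where k: "q = CHAR('a) ^ k" using primepow_eq_CHAR_power[OF q card] .
  have "prime (5::nat)" by simp
  hence "5 = CHAR('a)"
    using True k finite_field_prime_CHAR[where ?'a = 'a] by (metis prime_dvd_power primes_dvd_imp_eq)
  hence five: "(5::'a) = 0" using of_nat_CHAR[where ?'a = 'a] by (metis of_nat_numeral)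
  have "(b - 2)\<^sup>2 = (b\<^sup>2 + b - 1) + 5 * (1 - b)"
    by algebra
  hence "b = 1 + 1" using five b by simp
  thus ?thesis using finite_field_power_add[OF q card, of 1 1] by simp
next
  case False
  have "int (q mod 5) = 0 \<or> int (q mod 5) = 1 \<or> int (q mod 5) = 4"
    using mod5 by (simp add: cong_def zmod_int)
  hence q5: "q mod 5 = 1 \<or> q mod 5 = 4"
    using False by (simp add: dvd_eq_mod_eq_0)
  have "[q ^ 2 = 1] (mod 5)"
    using q5 power_mod[of q 5 2] by (auto simp: cong_def)
  hence "[(q ^ 2) ^ (n div 2) = 1 ^ (n div 2)] (mod 5)" by (rule cong_pow)
  hence "[CARD('a) = 1] (mod 5)" using n card by (simp flip: power_mult)
  then obtain z :: 'a where z: "z ^ 5 = 1" "z \<noteq> 1" using exists_primitive_fifth_root by blast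
  have "z ^ q = z ^ (5 * (q div 5) + q mod 5)" by simp
  also have "\<dots> = z ^ (q mod 5)" unfolding power_add power_mult z by simp
  finally have zq: "z ^ q = z \<or> z ^ q = z ^ 4" using q5 by auto
  have "(z - 1) * (z ^ 4 + z ^ 3 + z\<^sup>2 + z + 1) = z ^ 5 - 1" by algebra
  hence cyc: "z ^ 4 + z ^ 3 + z\<^sup>2 + z + 1 = 0" using z by simp
  have fixed: "(w + w ^ 4) ^ q = w + w ^ 4" if "w ^ 5 = 1" "w ^ q = w \<or> w ^ q = w ^ 4" for w :: 'a
  proof -
    have "(w + w ^ 4) ^ q = w ^ q + (w ^ q) ^ 4"
      by (simp add: finite_field_power_add[OF q card] mult.commute flip: power_mult)
    moreover have "(w ^ 4) ^ 4 = (w ^ 5) ^ 3 * w" by algebra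
    ultimately show ?thesis using that by auto
  qed
  have "(z\<^sup>2) ^ 4 = z ^ 5 * z ^ 3" by algebra
  hence z8: "(z\<^sup>2) ^ 4 = z ^ 3" using z by simp
  \<comment> \<open>The two Gaussian periods have sum and product -1, so they are the roots of
    \<open>X^2 + X - 1\<close>.\<close>
  have "(b - (z + z ^ 4)) * (b - (z\<^sup>2 + z ^ 3))
      = (b\<^sup>2 + b - 1) + (1 - b) * (z ^ 4 + z ^ 3 + z\<^sup>2 + z + 1) + (z ^ 5 - 1) * (z + z\<^sup>2)"
    by algebra
  also have "\<dots> = 0" unfolding cyc z b by simp
  finally have "(b - (z + z ^ 4)) * (b - (z\<^sup>2 + (z\<^sup>2) ^ 4)) = 0" unfolding z8 .
  hence "b = z + z ^ 4 \<or> b = z\<^sup>2 + (z\<^sup>2) ^ 4" by simp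
  moreover have "(z\<^sup>2) ^ 5 = 1" using z(1) by (metis mult.commute power_mult power_one)
  moreover have "(z\<^sup>2) ^ q = z\<^sup>2 \<or> (z\<^sup>2) ^ q = (z\<^sup>2) ^ 4"
    using zq by (metis mult.commute power_mult)
  ultimately show ?thesis using fixed[of z] fixed[of "z\<^sup>2"] z(1) zq by blast
qed

section \<open>Scatteredness of a graph by counting\<close>

text \<open>The equation in \<open>scattered\<close> says that \<open>(x, G x)\<close> and
  \<open>(y, G y)\<close> are proportional over the large field. Each point of the linear set then
  carries exactly \<open>CARD('k) - 1\<close> nonzero vectors, and counting \<open>U - {0}\<close>
  by points gives the size.\<close>

lemma maximum_scattered_graph:
  fixes h :: "'k::{field,finite} \<Rightarrow> 'l::{field,finite}" and G :: "'l \<Rightarrow> 'l"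
  assumes h: "field_embedding h" and card: "CARD('l) = CARD('k) ^ n"
    and G_add: "\<And>x y. G (x + y) = G x + G y"
    and G_scale: "\<And>c x. G (h c * x) = h c * G x"
    and scattered: "\<And>x y. x \<noteq> 0 \<Longrightarrow> x * G y = y * G x \<Longrightarrow> y / x \<in> range h"
  shows "maximum_scattered h n {(x, G x) | x. x \<in> UNIV}"
proof -
  interpret field_embedding h by fact
  interpret K: vector_space "restr_scale h" by (rule vector_space_restr_scale)
  interpret L: vector_space "pair_scale :: 'l \<Rightarrow> _" by (rule vector_space_pair_scale)
  define U where "U = {(x, G x) | x. x \<in> UNIV}"
  have G0: "G 0 = 0" using G_scale[of 0 0] by (simp add: hom_zero)
  have sub: "K.subspace U"
    by (rule K.subspaceI)
      (auto simp: U_def G0 G_add G_scale restr_scale_def pair_scale_def zero_prod_def)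
  have "U = range (\<lambda>x. (x, G x))" by (auto simp: U_def)
  hence cardU: "card U = CARD('l)" by (simp add: card_image inj_on_def)
  have gt: "CARD('k) > 1"
    using card_mono[of UNIV "{0,1::'k}"] by simp
  have dim: "K.dim U = n"
    using K.card_eq_power_dim[OF _ _ sub] cardU card gt by simp
  have span: "L.span {u} = range (\<lambda>c. pair_scale c u)" for u
    by (simp add: L.span_singleton)
  have fibre: "card {v \<in> U - {0}. L.span {v} = L.span {u}} = CARD('k) - 1" if u: "u \<in> U - {0}" for u
  proof -
    obtain x where x: "u = (x, G x)" "x \<noteq> 0"
      using u G0 by (auto simp: U_def zero_prod_def)
    have "{v \<in> U - {0}. L.span {v} = L.span {u}} = (\<lambda>c. restr_scale h c u) ` (UNIV - {0})"
    proof (intro equalityI subsetI)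
      fix v assume v: "v \<in> {v \<in> U - {0}. L.span {v} = L.span {u}}"
      then obtain y where y: "v = (y, G y)" "v \<noteq> 0" by (auto simp: U_def)
      have "v \<in> L.span {u}" using v L.span_base[of v "{v}"] by auto
      then obtain c where "y = c * x" "G y = c * G x"
        by (auto simp: span x y pair_scale_def)
      hence "y / x \<in> range h" by (intro scattered x) simp
      then obtain k where "y / x = h k" by auto
      hence k: "y = h k * x" using x by (simp add: field_simps)
      hence "v = restr_scale h k u" by (simp add: y x G_scale restr_scale_def pair_scale_def)
      moreover from this have "k \<noteq> 0" using y by (auto simp: K.scale_zero_left)
      ultimately show "v \<in> (\<lambda>c. restr_scale h c u) ` (UNIV - {0})" by auto
    next
      fix v assume "v \<in> (\<lambda>c. restr_scale h c u) ` (UNIV - {0})"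
      then obtain c where c: "c \<noteq> 0" "v = restr_scale h c u" by auto
      have "v \<in> U" using c u K.subspace_scale[OF sub] by auto
      moreover have "v \<noteq> 0" using c u K.scale_eq_0_iff by auto
      moreover have "L.span {v} = L.span {u}"
      proof -
        have "range (\<lambda>d. pair_scale d v) = (\<lambda>d. pair_scale d u) ` range (\<lambda>d. d * h c)"
          by (auto simp: c restr_scale_def)
        also have "range (\<lambda>d. d * h c) = UNIV"
          using c(1) hom_eq_0_iff by (intro surjI[of _ "\<lambda>d. d / h c"]) simp
        finally show ?thesis by (simp add: span)
      qed
      ultimately show "v \<in> {v \<in> U - {0}. L.span {v} = L.span {u}}" by simp
    qed
    moreover have "inj_on (\<lambda>c. restr_scale h c u) (UNIV - {0})"
      using u by (auto intro!: inj_onI)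
    ultimately show ?thesis by (simp add: card_image card_Diff_singleton)
  qed
  have "CARD('k) ^ n - 1 = card (U - {0})"
    using cardU card K.subspace_0[OF sub] by (simp add: card_Diff_singleton)
  also have "\<dots> = (\<Sum>s\<in>linear_set U. card {v \<in> U - {0}. L.span {v} = s})"
    unfolding card_eq_sum by (rule sum.group[symmetric]) (auto simp: linear_set_def)
  also have "\<dots> = (\<Sum>s\<in>linear_set U. CARD('k) - 1)"
    by (rule sum.cong) (use fibre in \<open>auto simp: linear_set_def\<close>)
  finally have "card (linear_set U) = (CARD('k) ^ n - 1) div (CARD('k) - 1)"
    using gt by simp
  with sub dim show ?thesis
    unfolding maximum_scattered_def U_def by simp
qed

theorem theorem5p1:
  fixes q :: nat
    and h :: "'k::{field,finite} \<Rightarrow> 'l::{field,finite}"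
    and b :: 'l
    and g :: "'l poly"
  assumes "primepow q" and "odd q"
    and "[int q = 0] (mod 5) \<or> [int q = 1] (mod 5) \<or> [int q = -1] (mod 5)"
    and "CARD('k) = q" and "CARD('l) = q ^ 6"
    and "field_embedding h"
    and "b\<^sup>2 + b = 1"
    and "g = monom 1 q + monom 1 (q ^ 3) + monom b (q ^ 5)"
  shows "b \<in> range h \<and> maximum_scattered h 6 {(x, poly g x) | x. x \<in> UNIV}"
proof -
  interpret field_embedding h by fact
  define \<phi> :: "'l \<Rightarrow> 'l" where "\<phi> x = x ^ q" for x
  have pow: "x ^ (q ^ Suc n) = (x ^ q ^ n) ^ q" for x :: 'l and n
    by (simp add: mult.commute flip: power_mult)
  have six: "\<phi> (\<phi> (\<phi> (\<phi> (\<phi> (\<phi> x))))) = x ^ (q ^ 6)" for x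
    by (simp add: \<phi>_def eval_nat_numeral pow del: power_Suc)
  interpret order6_automorphism \<phi>
  proof
    show "\<phi> (x + y) = \<phi> x + \<phi> y" for x y
      by (simp add: \<phi>_def finite_field_power_add[OF assms(1,5)])
    show "\<phi> (\<phi> (\<phi> (\<phi> (\<phi> (\<phi> x))))) = x" for x
      using finite_field_power_card[of x] assms(5) by (simp add: six)
  qed (simp_all add: \<phi>_def power_mult_distrib)
  have two_neq: "(2::'l) \<noteq> 0"
    by (rule finite_field_two_neq_0) (simp add: assms)
  have fixed: "\<phi> x = x \<longleftrightarrow> x \<in> range h" for x
    using power_card_fixed_iff_in_range[OF assms(6), of x] by (simp add: \<phi>_def assms(4))
  have fb: "\<phi> b = b"
    unfolding \<phi>_def by (rule golden_root_power_eq_self[OF assms(1,5) _ assms(3,7)]) simp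
  have g: "poly g x = \<phi> x + \<phi> (\<phi> (\<phi> x)) + b * \<phi> (\<phi> (\<phi> (\<phi> (\<phi> x))))" for x
    by (simp add: assms(8) poly_monom \<phi>_def eval_nat_numeral pow del: power_Suc)
  have "maximum_scattered h 6 {(x, poly g x) | x. x \<in> UNIV}"
  proof (rule maximum_scattered_graph[OF assms(6)])
    show "CARD('l) = CARD('k) ^ 6" by (simp add: assms)
    show "poly g (x + y) = poly g x + poly g y" for x y
      by (simp add: g add algebra_simps)
    show "poly g (h c * x) = h c * poly g x" for c x
      using fixed[of "h c"] by (simp add: g mult algebra_simps)
    show "y / x \<in> range h" if x: "x \<noteq> 0" and eq: "x * poly g y = y * poly g x" for x y
    proof -
      \<comment> \<open>The common multiplier \<open>m\<close> is
        \<open>poly g x / x\<close>.\<close>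
      have "poly g x = (poly g x / x) * x" "poly g y = (poly g x / x) * y"
        using x eq by (simp_all add: field_simps)
      hence *: "x * \<phi> y = \<phi> x * y"
        unfolding g by (rule fixed_ratio_if_common_multiplier[OF two_neq assms(7) fb x])
      have "\<phi> (y / x) * \<phi> x = \<phi> y" using x by (simp flip: mult)
      hence "\<phi> x * (x * \<phi> (y / x)) = \<phi> x * y" using * by (simp add: mult_ac)
      hence "\<phi> (y / x) = y / x" using x eq_0_iff[of x] by (simp add: field_simps)
      thus ?thesis by (simp add: fixed)
    qed
  qed
  moreover have "b \<in> range h" using fb fixed by simp
  ultimately show ?thesis by simp
qed

end
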